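(* Let $L$ be a finite sequence of colored items all of which have size zero. Then $L$ can be packed validly, without reordering, into $\mathrm{LB}_2(L)$ bins, where, writing the items as $1,\dots,n$ and setting $s_{c,\ell}=1$ if item $\ell$ has color $c$ and $s_{c,\ell}=-1$ otherwise, $\mathrm{LB}_2(L) = \max_{c \in C}\max_{1\le i\le j\le n}\sum_{\ell=i}^{j} s_{c,\ell}$.
   Context: Colored Bin Packing: items arrive as a sequence; each item has a size in $[0,1]$ and a color from a finite set $C$. A packing assigns every item to a bin of unit capacity; the items in a bin are ordered by their position in the input sequence (no reordering). A packing is valid if in every bin the total size is at most $1$ and no two items that are consecutive in that bin (in this order) have the same color. *)

theory Defs
  imports Complex_Main
begin

datatype 'c item = Item (item_size: real) (item_color: 'c)

definition cbp_instance :: "'c set \<Rightarrow> 'c item list \<Rightarrow> bool" where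
  "cbp_instance C L \<longleftrightarrow>
     finite C \<and> (\<forall>x \<in> set L. 0 \<le> item_size x \<and> item_size x \<le> 1 \<and> item_color x \<in> C)"

text \<open>Items are indexed from 0, and \<open>p i\<close> is the bin of item \<open>i\<close>.\<close>

definition bin_items :: "'c item list \<Rightarrow> (nat \<Rightarrow> nat) \<Rightarrow> nat \<Rightarrow> 'c item list" where
  "bin_items L p b = map (\<lambda>i. L ! i) (filter (\<lambda>i. p i = b) [0..<length L])"

definition valid_packing :: "'c item list \<Rightarrow> nat \<Rightarrow> (nat \<Rightarrow> nat) \<Rightarrow> bool" where
  "valid_packing L k p \<longleftrightarrow>
     (\<forall>i < length L. p i < k) \<and>
     (\<forall>b < k. (\<Sum>x \<leftarrow> bin_items L p b. item_size x) \<le> 1 \<and>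
              distinct_adj (map item_color (bin_items L p b)))"

definition color_sign :: "'c item list \<Rightarrow> 'c \<Rightarrow> nat \<Rightarrow> int" where
  "color_sign L c l = (if item_color (L ! l) = c then 1 else - 1)"

text \<open>For the empty sequence the maximum ranges over the empty set; it is taken to be 0.\<close>

definition LB2 :: "'c set \<Rightarrow> 'c item list \<Rightarrow> int" where
  "LB2 C L = (if L = [] then 0 else
     Max ((\<lambda>c. Max {(\<Sum>l = i..j. color_sign L c l) | i j. i \<le> j \<and> j < length L}) ` C))"

end

theory Submission
  imports Defs
begin

text \<open>
  For a sequence \<open>w\<close> of colors let \<open>demand c w\<close> be the maximum over all prefixes of \<open>w\<close> (the empty
  one included) of the number of items of color \<open>c\<close> minus the number of other items. Pack the items in order
  into \<open>k = LB\<^sub>2\<close> bins, maintaining for every color \<open>c\<close> that the number of bins with top color \<open>c\<close>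
  plus the demand of \<open>c\<close> in the remaining sequence is at most \<open>k\<close>. When an item of color \<open>c\<close>
  arrives, the invariant can only fail for a color \<open>d \<noteq> c\<close> with equality before the step, and then
  it is restored by putting the item on a bin with top color \<open>d\<close>. There is at most one such \<open>d\<close>,
  because the demands of two different colors sum to at most \<open>k\<close>.
\<close>

text \<open>The truncated subtraction accounts for the empty prefix.\<close>

fun demand :: "'c \<Rightarrow> 'c list \<Rightarrow> nat" where
  "demand c [] = 0"
| "demand c (x # xs) = (if x = c then Suc (demand c xs) else demand c xs - 1)"

lemma demand_eq_0: "c \<notin> set w \<Longrightarrow> demand c w = 0"
  by (induction w) auto

text \<open>Positivity rules out the empty prefix, so the maximum is attained at a nonempty one.
  This turns \<open>demand\<close> into an interval sum.\<close>

lemma demand_eq_prefix_sum: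
  assumes "0 < demand c w"
  shows "\<exists>m < length w. int (demand c w) = (\<Sum>l\<le>m. if w ! l = c then 1 else - 1)"
  using assms
proof (induction w)
  case (Cons x xs)
  show ?case
  proof (cases "demand c xs = 0")
    case True
    with Cons.prems have "x = c" by (auto split: if_splits)
    with True show ?thesis by (intro exI[of _ 0]) auto
  next
    case False
    with Cons.IH obtain m where "m < length xs"
      and "int (demand c xs) = (\<Sum>l\<le>m. if xs ! l = c then 1 else - 1)" by auto
    with False show ?thesis
      by (intro exI[of _ "Suc m"]) (auto simp: sum.atMost_Suc_shift simp del: sum.atMost_Suc)
  qed
qed simp

text \<open>Prepending an item raises at most one of the two demands and lowers the other unless
  that is 0. So the sum grows only if one demand is and stays 0, and then it equals the other, which
  is at most \<open>k\<close>.\<close>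

lemma demand_add_le:
  assumes "d \<noteq> e" and "\<And>n c. demand c (drop n w) \<le> k"
  shows "demand d w + demand e w \<le> k"
  using assms(2)
proof (induction w)
  case (Cons x xs)
  have "demand c (drop n xs) \<le> k" for n c
    using Cons.prems[of c "Suc n"] by simp
  then have "demand d xs + demand e xs \<le> k" by (rule Cons.IH)
  with Cons.prems[of d 0] Cons.prems[of e 0] assms(1) show ?case by auto
qed simp

text \<open>\<open>f b\<close> is the color of the last item in bin \<open>b\<close>, or
  \<open>None\<close> if the bin is empty.\<close>

definition tops :: "nat \<Rightarrow> (nat \<Rightarrow> 'c option) \<Rightarrow> 'c \<Rightarrow> nat set" where
  "tops k f c = {b. b < k \<and> f b = Some c}"

lemma finite_tops [simp]: "finite (tops k f c)"
  by (simp add: tops_def)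

lemma card_tops_add_le:
  assumes "d \<noteq> e"
  shows "card (tops k f d) + card (tops k f e) \<le> k"
proof -
  have "card (tops k f d) + card (tops k f e) = card (tops k f d \<union> tops k f e)"
    by (rule card_Un_disjoint[symmetric]) (use assms in \<open>auto simp: tops_def\<close>)
  also have "\<dots> \<le> card {..<k}"
    by (rule card_mono) (auto simp: tops_def)
  finally show ?thesis by simp
qed

lemma packing_step:
  fixes f :: "nat \<Rightarrow> 'c option"
  assumes bound: "\<And>n c. demand c (drop n (x # xs)) \<le> k"
    and inv: "\<And>c. card (tops k f c) + demand c (x # xs) \<le> k"
  obtains b where "b < k" "f b \<noteq> Some x"
    "\<And>c. card (tops k (f(b := Some x)) c) + demand c xs \<le> k"
proof -
  have bound': "demand c (drop n xs) \<le> k" for n c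
    using bound[of c "Suc n"] by simp
  \<comment> \<open>The colors whose invariant breaks unless \<open>x\<close> covers a bin with top
    \<open>d\<close>.\<close>
  define critical where
    "critical d \<longleftrightarrow> d \<noteq> x \<and> k < card (tops k f d) + demand d xs" for d
  \<comment> \<open>Two critical colors would push the total above \<open>2 * k\<close>, but the top
    counts and the demands each add up to at most \<open>k\<close>.\<close>
  have unique: "d = e" if "critical d" "critical e" for d e
  proof (rule ccontr)
    assume "d \<noteq> e"
    then have "card (tops k f d) + card (tops k f e) \<le> k" by (rule card_tops_add_le)
    moreover from \<open>d \<noteq> e\<close> bound' have "demand d xs + demand e xs \<le> k" by (rule demand_add_le)
    ultimately show False using that by (simp add: critical_def)
  qed
  have "\<exists>b < k. f b \<noteq> Some x \<and> (\<forall>d. critical d \<longrightarrow> f b = Some d)"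
  proof (cases "\<exists>d. critical d")
    case True
    then obtain d where d: "critical d" by blast
    with bound'[of d 0] have "card (tops k f d) > 0" by (auto simp: critical_def)
    then obtain b where "b \<in> tops k f d" by (auto simp: card_gt_0_iff)
    moreover have "d \<noteq> x" using d by (simp add: critical_def)
    ultimately have "b < k" "f b = Some d" "f b \<noteq> Some x" by (auto simp: tops_def)
    then show ?thesis using unique[OF d] by blast
  next
    case False
    \<comment> \<open>The arriving item makes the demand of \<open>x\<close> at least 1, which
      leaves a bin whose top is not \<open>x\<close>.\<close>
    have "card (tops k f x) < k" using inv[of x] by simp
    then have "tops k f x \<noteq> {..<k}" by (metis card_lessThan less_irrefl)
    then show ?thesis using False by (auto simp: tops_def)
  qed
  then obtain b where b: "b < k" "f b \<noteq> Some x" "\<And>d. critical d \<Longrightarrow> f b = Some d"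
    by blast
  have "card (tops k (f(b := Some x)) c) + demand c xs \<le> k" for c
  proof (cases "c = x")
    case True
    have "tops k (f(b := Some x)) x = insert b (tops k f x)"
      using b by (auto simp: tops_def)
    moreover have "b \<notin> tops k f x" using b by (simp add: tops_def)
    ultimately show ?thesis using inv[of x] True by simp
  next
    case False
    then have eq: "tops k (f(b := Some x)) c = tops k f c - {b}"
      by (auto simp: tops_def)
    show ?thesis
    proof (cases "critical c")
      case True
      with b have mem: "b \<in> tops k f c" by (simp add: tops_def)
      then have "0 < card (tops k f c)" by (auto simp: card_gt_0_iff)
      \<comment> \<open>Dropping an item of another color raises the demand of \<open>c\<close> by
        at most 1; the loss of the top of \<open>b\<close> offsets this.\<close>
      with mem eq inv[of c] False show ?thesis by simp
    next
      case False
      have "card (tops k f c - {b}) \<le> card (tops k f c)"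
        by (rule card_mono) auto
      with False \<open>c \<noteq> x\<close> eq show ?thesis by (simp add: critical_def)
    qed
  qed
  with b that show ?thesis by blast
qed

definition subseq_of_bin :: "'c list \<Rightarrow> (nat \<Rightarrow> nat) \<Rightarrow> nat \<Rightarrow> 'c list" where
  "subseq_of_bin w p b = map (\<lambda>i. w ! i) (filter (\<lambda>i. p i = b) [0..<length w])"

lemma subseq_of_bin_Cons:
  "subseq_of_bin (x # xs) (case_nat a p) b =
     (if a = b then x # subseq_of_bin xs p b else subseq_of_bin xs p b)"
proof -
  have "[0..<length (x # xs)] = 0 # map Suc [0..<length xs]"
    by (simp add: map_Suc_upt upt_conv_Cons del: upt_Suc)
  then show ?thesis
    by (simp add: subseq_of_bin_def filter_map comp_def del: upt_Suc)
qed

definition top_list :: "'c option \<Rightarrow> 'c list" where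
  "top_list t = (case t of None \<Rightarrow> [] | Some c \<Rightarrow> [c])"

text \<open>Only the last color of a bin constrains what follows, so arbitrary tops \<open>f\<close>
  stand for a partial packing and make the induction go through.\<close>

lemma packing_exists:
  fixes f :: "nat \<Rightarrow> 'c option"
  assumes "\<And>n c. demand c (drop n w) \<le> k"
    and "\<And>c. card (tops k f c) + demand c w \<le> k"
  shows "\<exists>p. (\<forall>i < length w. p i < k) \<and>
    (\<forall>b < k. distinct_adj (top_list (f b) @ subseq_of_bin w p b))"
  using assms
proof (induction w arbitrary: f)
  case Nil
  show ?case by (auto simp: subseq_of_bin_def top_list_def split: option.split)
next
  case (Cons x xs)
  obtain a where a: "a < k" "f a \<noteq> Some x"
    and inv: "\<And>c. card (tops k (f(a := Some x)) c) + demand c xs \<le> k"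
    using packing_step[OF Cons.prems] by blast
  have "demand c (drop n xs) \<le> k" for n c
    using Cons.prems(1)[of c "Suc n"] by simp
  from Cons.IH[OF this inv] obtain p where p: "\<And>i. i < length xs \<Longrightarrow> p i < k"
    "\<And>b. b < k \<Longrightarrow> distinct_adj (top_list ((f(a := Some x)) b) @ subseq_of_bin xs p b)"
    by blast
  \<comment> \<open>\<open>case_nat a p\<close> puts the first item into bin \<open>a\<close> and
    shifts the packing of the rest.\<close>
  have "distinct_adj (top_list (f b) @ subseq_of_bin (x # xs) (case_nat a p) b)" if "b < k" for b
    using p(2)[OF that] a(2)
    by (auto simp: subseq_of_bin_Cons top_list_def split: option.splits if_splits)
  moreover have "case_nat a p i < k" if "i < length (x # xs)" for i
    using that a(1) p(1) by (cases i) auto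
  ultimately show ?case by blast
qed

lemma map_item_color_bin_items:
  "map item_color (bin_items L p b) = subseq_of_bin (map item_color L) p b"
  by (auto simp: bin_items_def subseq_of_bin_def)

lemma interval_sum_le_LB2:
  assumes "finite C" "c \<in> C" "i \<le> j" "j < length L"
  shows "(\<Sum>l = i..j. color_sign L c l) \<le> LB2 C L"
proof -
  let ?S = "\<lambda>c. {(\<Sum>l = i..j. color_sign L c l) | i j. i \<le> j \<and> j < length L}"
  have "?S c \<subseteq> (\<lambda>(i, j). \<Sum>l = i..j. color_sign L c l) ` ({..<length L} \<times> {..<length L})"
    by force
  then have "finite (?S c)" by (rule finite_subset) simp
  then have "(\<Sum>l = i..j. color_sign L c l) \<le> Max (?S c)"
    using assms by (intro Max_ge) auto
  also have "\<dots> \<le> Max ((\<lambda>c. Max (?S c)) ` C)"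
    using assms by (intro Max_ge) auto
  also have "\<dots> = LB2 C L" using assms by (auto simp: LB2_def)
  finally show ?thesis .
qed

text \<open>The first item alone, taken with its own color, already gives the sum 1.\<close>

lemma LB2_nonneg:
  assumes "cbp_instance C L"
  shows "0 \<le> LB2 C L"
proof (cases "L = []")
  case False
  then have "item_color (L ! 0) \<in> C" "finite C"
    using assms by (auto simp: cbp_instance_def)
  then have "(\<Sum>l = 0..0. color_sign L (item_color (L ! 0)) l) \<le> LB2 C L"
    using False by (intro interval_sum_le_LB2) auto
  then show ?thesis by (simp add: color_sign_def)
qed (simp add: LB2_def)

lemma demand_le_LB2:
  assumes "cbp_instance C L"
  shows "int (demand c (drop n (map item_color L))) \<le> LB2 C L"
proof (cases "demand c (drop n (map item_color L)) = 0")
  case True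
  then show ?thesis using LB2_nonneg[OF assms] by simp
next
  case False
  let ?w = "drop n (map item_color L)"
  \<comment> \<open>\<open>LB2\<close> ranges over \<open>C\<close> only; a positive demand forces
    \<open>c\<close> to occur in \<open>L\<close>.\<close>
  have "c \<in> set ?w" using False demand_eq_0 by metis
  then have "c \<in> set (map item_color L)" by (rule in_set_dropD)
  then have "c \<in> C" using assms by (auto simp: cbp_instance_def)
  from False have "0 < demand c ?w" by simp
  from demand_eq_prefix_sum[OF this] obtain m where m: "m < length ?w"
    "int (demand c ?w) = (\<Sum>l\<le>m. if ?w ! l = c then 1 else - 1)"
    by blast
  have "int (demand c ?w) = (\<Sum>l = 0..m. color_sign L c (l + n))"
    unfolding m(2) atLeast0AtMost
    by (rule sum.cong) (use m(1) in \<open>auto simp: color_sign_def add.commute\<close>)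
  also have "\<dots> = (\<Sum>l = n..m + n. color_sign L c l)"
    using sum.shift_bounds_cl_nat_ivl[of "color_sign L c" 0 n m] by simp
  also have "\<dots> \<le> LB2 C L"
    using assms \<open>c \<in> C\<close> m(1) by (intro interval_sum_le_LB2) (auto simp: cbp_instance_def)
  finally show ?thesis .
qed

theorem theorem2p3:
  fixes C :: "'c set" and L :: "'c item list"
  assumes "cbp_instance C L"
    and "\<forall>x \<in> set L. item_size x = 0"
  shows "\<exists>k p. int k = LB2 C L \<and> valid_packing L k p"
proof -
  define k where "k = nat (LB2 C L)"
  have k: "int k = LB2 C L" using LB2_nonneg[OF assms(1)] by (simp add: k_def)
  let ?w = "map item_color L"
  have bound: "demand c (drop n ?w) \<le> k" for n c
    using demand_le_LB2[OF assms(1), of c n] k by linarith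
  \<comment> \<open>All bins start empty, so the initial invariant is the bound for the whole
    sequence.\<close>
  have "card (tops k (\<lambda>_. None) c) + demand c ?w \<le> k" for c
    using bound[of c 0] by (simp add: tops_def)
  from packing_exists[OF bound this] obtain p where p: "\<And>i. i < length L \<Longrightarrow> p i < k"
    "\<And>b. b < k \<Longrightarrow> distinct_adj (subseq_of_bin ?w p b)"
    by (auto simp: top_list_def)
  have "(\<Sum>x \<leftarrow> bin_items L p b. item_size x) \<le> 0" for b
    by (rule sum_list_nonpos) (use assms(2) in \<open>auto simp: bin_items_def\<close>)
  then have "(\<Sum>x \<leftarrow> bin_items L p b. item_size x) \<le> 1" for b
    by (rule order_trans) simp
  with p have "valid_packing L k p"
    unfolding valid_packing_def map_item_color_bin_items by blast
  with k show ?thesis by blast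
qed

end
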